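(* Consider a radial power network on a graph $G=(N,L)$, and the optimal power flow problem (OPF) $$\min_x f(x)\quad\text{s.t.}\quad x\in\mathbb X_{\text{tree}},\ \ \underline s\le s\le\overline s,\ \ \underline v\le v\le\overline v,\ \ 0\le\ell\le\overline\ell,$$ and its second-order cone (SOCP) relaxation $$\min_x f(x)\quad\text{s.t.}\quad x\in\mathbb X_{\text{soc}},\ \ \underline s\le s\le\overline s,\ \ \underline v\le v\le\overline v,\ \ 0\le\ell\le\overline\ell,$$ where $x=(s,v,\ell,S)\in\mathbb R^{3(N+2L)}$ and the sets $\mathbb X_{\text{tree}}$, $\mathbb X_{\text{soc}}$ are defined in the context. Assume: - (A1) the network graph $G$ is connected; - (A2) the cost function $f$ is strictly increasing in $\ell$, nondecreasing in $s$ and independent of $S$; - (A3) the OPF problem is feasible. If the two conditions - (C1) $\underline s_j=(-\infty,-\infty)$ for all buses $j\in N$, - (C2) both $\mathrm{Re}(\alpha_{jk})$ and $\mathrm{Re}(\alpha_{kj})$ are strictly positive for every line $j\sim k$, hold, then every optimal solution of the SOCP relaxation is in $\mathbb X_{\text{tree}}$ and hence optimal for the OPF problem.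
   Context: **Network.** $G=(N,L)$ is an undirected graph with bus set $N=\{1,\dots,N\}$ and line set $L\subseteq N\times N$ ($N$ and $L$ also denote the numbers of buses and lines). Write $j\sim k$ if $(j,k)\in L$. Radial means the graph has a tree topology. Each line $(j,k)\in L$ has a nonzero series admittance $y^s_{jk}=y^s_{kj}\in\mathbb C$ and shunt admittances $y^m_{jk},y^m_{kj}\in\mathbb C$ (at bus $j$ and bus $k$ respectively, not necessarily equal). Put $z_{jk}=z_{kj}:=1/y^s_{jk}$, $\alpha_{jk}:=1+z_{jk}y^m_{jk}$, $\alpha_{kj}:=1+z_{kj}y^m_{kj}$. A star denotes complex conjugation. **Variables.** $x=(s,v,\ell,S)\in\mathbb R^{3(N+2L)}$, where $s_j\in\mathbb C\cong\mathbb R^2$ (real and reactive power injection) and $v_j\in\mathbb R$ for $j\in N$, and for each line $(j,k)\in L$ there are variables in both directions: $\ell_{jk},\ell_{kj}\in\mathbb R$ and $S_{jk},S_{kj}\in\mathbb C\cong\mathbb R^2$. Complex quantities are identified with pairs of reals, and inequalities between real vectors are componentwise. The bounds $\underline s,\overline s,\underline v,\overline v,\overline\ell$ are given. **Equations.** For all $j\in N$ and all $(j,k)\in L$: (a) $s_j=\sum_{k:j\sim k}S_{jk}$; (b) $v_j\ell_{jk}=|S_{jk}|^2$ and $v_k\ell_{kj}=|S_{kj}|^2$; (b') $|S_{jk}|^2\le v_j\ell_{jk}$ and $|S_{kj}|^2\le v_k\ell_{kj}$; (c) $|\alpha_{jk}|^2v_j-v_k=2\,\mathrm{Re}(\alpha_{jk}z_{jk}^*S_{jk})-|z_{jk}|^2\ell_{jk}$;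 (d) $|\alpha_{kj}|^2v_k-v_j=2\,\mathrm{Re}(\alpha_{kj}z_{kj}^*S_{kj})-|z_{kj}|^2\ell_{kj}$; (e) $\alpha_{jk}^*v_j-z_{jk}^*S_{jk}=\left(\alpha_{kj}^*v_k-z_{kj}^*S_{kj}\right)^*$. **Sets.** $\mathbb X_{\text{tree}}:=\{x\in\mathbb R^{3(N+2L)}: x\text{ satisfies (a), (b), (c), (d), (e)},\ v_1=1\}$, $\mathbb X_{\text{soc}}:=\{x\in\mathbb R^{3(N+2L)}: x\text{ satisfies (a), (b'), (c), (d), (e)},\ v_1=1\}$.
   Formalization: The formal theorem additionally assumes Re(z_jk) ≥ 0 and Im(z_jk) ≥ 0 (nonnegative series resistance and reactance) for every line; with merely nonzero series admittance the claim is false, e.g. on two buses with z = 1 − i. *)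

theory Defs
  imports "HOL-Analysis.Analysis"
begin

section \<open>Networks\<close>

text \<open>
  The buses are \<open>1, \<dots>, nbus\<close>. Every undirected line occurs in \<open>lines\<close> exactly once, as an ordered
  pair in an arbitrary orientation. The series admittance \<open>ys j k\<close> and the shunt admittances
  \<open>ym j k\<close> (at bus \<open>j\<close>) and \<open>ym k j\<close> (at bus \<open>k\<close>) are only relevant when \<open>j\<close> and \<open>k\<close> are adjacent.
\<close>

record network =
  nbus :: nat
  lines :: "(nat \<times> nat) set"
  ys :: "nat \<Rightarrow> nat \<Rightarrow> complex"
  ym :: "nat \<Rightarrow> nat \<Rightarrow> complex"

definition buses :: "network \<Rightarrow> nat set" where
  "buses G = {1..nbus G}"

definition dlines :: "network \<Rightarrow> (nat \<times> nat) set" where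
  "dlines G = lines G \<union> (lines G)\<inverse>"

definition power_network :: "network \<Rightarrow> bool" where
  "power_network G \<longleftrightarrow>
     1 \<le> nbus G \<and> lines G \<subseteq> buses G \<times> buses G \<and>
     irrefl (lines G) \<and> asym (lines G) \<and>
     (\<forall>(j, k) \<in> lines G. ys G j k \<noteq> 0 \<and> ys G j k = ys G k j)"

definition network_connected :: "network \<Rightarrow> bool" where
  "network_connected G \<longleftrightarrow> (\<forall>j\<in>buses G. \<forall>k\<in>buses G. (j, k) \<in> (dlines G)\<^sup>*)"

definition network_cycle :: "network \<Rightarrow> nat list \<Rightarrow> bool" where
  "network_cycle G c \<longleftrightarrow>
     3 \<le> length c \<and> distinct c \<and>
     (\<forall>i<length c. (c ! i, c ! (Suc i mod length c)) \<in> dlines G)"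

definition radial :: "network \<Rightarrow> bool" where
  "radial G \<longleftrightarrow> network_connected G \<and> \<not> (\<exists>c. network_cycle G c)"

definition zs :: "network \<Rightarrow> nat \<Rightarrow> nat \<Rightarrow> complex" where
  "zs G j k = 1 / ys G j k"

definition \<alpha> :: "network \<Rightarrow> nat \<Rightarrow> nat \<Rightarrow> complex" where
  "\<alpha> G j k = 1 + zs G j k * ym G j k"


section \<open>Variables and branch flow equations\<close>

record opf_vars =
  s_var :: "nat \<Rightarrow> complex"
  v_var :: "nat \<Rightarrow> real"
  \<l>_var :: "nat \<times> nat \<Rightarrow> real"
  S_var :: "nat \<times> nat \<Rightarrow> complex"

text \<open>
  The space of dimension \<open>3(N + 2L)\<close>: coordinates outside the index sets are fixed to
  \<open>undefined\<close>, so that a point is determined by its actual coordinates.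
\<close>

definition opf_space :: "network \<Rightarrow> opf_vars set" where
  "opf_space G = {x. s_var x \<in> buses G \<rightarrow>\<^sub>E UNIV \<and> v_var x \<in> buses G \<rightarrow>\<^sub>E UNIV \<and>
                     \<l>_var x \<in> dlines G \<rightarrow>\<^sub>E UNIV \<and> S_var x \<in> dlines G \<rightarrow>\<^sub>E UNIV}"

definition power_balance :: "network \<Rightarrow> opf_vars \<Rightarrow> bool" where
  "power_balance G x \<longleftrightarrow> (\<forall>j\<in>buses G. s_var x j = (\<Sum>k | (j, k) \<in> dlines G. S_var x (j, k)))"

definition current_eq :: "network \<Rightarrow> opf_vars \<Rightarrow> bool" where
  "current_eq G x \<longleftrightarrow> (\<forall>(j, k) \<in> lines G.
     v_var x j * \<l>_var x (j, k) = (cmod (S_var x (j, k)))\<^sup>2 \<and>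
     v_var x k * \<l>_var x (k, j) = (cmod (S_var x (k, j)))\<^sup>2)"

definition current_soc :: "network \<Rightarrow> opf_vars \<Rightarrow> bool" where
  "current_soc G x \<longleftrightarrow> (\<forall>(j, k) \<in> lines G.
     (cmod (S_var x (j, k)))\<^sup>2 \<le> v_var x j * \<l>_var x (j, k) \<and>
     (cmod (S_var x (k, j)))\<^sup>2 \<le> v_var x k * \<l>_var x (k, j))"

definition voltage_drop :: "network \<Rightarrow> opf_vars \<Rightarrow> bool" where
  "voltage_drop G x \<longleftrightarrow> (\<forall>(j, k) \<in> lines G.
     (cmod (\<alpha> G j k))\<^sup>2 * v_var x j - v_var x k =
       2 * Re (\<alpha> G j k * cnj (zs G j k) * S_var x (j, k)) - (cmod (zs G j k))\<^sup>2 * \<l>_var x (j, k) \<and>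
     (cmod (\<alpha> G k j))\<^sup>2 * v_var x k - v_var x j =
       2 * Re (\<alpha> G k j * cnj (zs G k j) * S_var x (k, j)) - (cmod (zs G k j))\<^sup>2 * \<l>_var x (k, j))"

definition angle_consistency :: "network \<Rightarrow> opf_vars \<Rightarrow> bool" where
  "angle_consistency G x \<longleftrightarrow> (\<forall>(j, k) \<in> lines G.
     cnj (\<alpha> G j k) * of_real (v_var x j) - cnj (zs G j k) * S_var x (j, k) =
     cnj (cnj (\<alpha> G k j) * of_real (v_var x k) - cnj (zs G k j) * S_var x (k, j)))"

definition X_tree :: "network \<Rightarrow> opf_vars set" where
  "X_tree G = {x \<in> opf_space G. power_balance G x \<and> current_eq G x \<and> voltage_drop G x \<and>
                                angle_consistency G x \<and> v_var x 1 = 1}"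

definition X_soc :: "network \<Rightarrow> opf_vars set" where
  "X_soc G = {x \<in> opf_space G. power_balance G x \<and> current_soc G x \<and> voltage_drop G x \<and>
                               angle_consistency G x \<and> v_var x 1 = 1}"


section \<open>Optimal power flow and its relaxation\<close>

text \<open>Bounds are extended reals, so that any of them may be absent.\<close>

record opf_bounds =
  s_min :: "nat \<Rightarrow> ereal \<times> ereal"
  s_max :: "nat \<Rightarrow> ereal \<times> ereal"
  v_min :: "nat \<Rightarrow> ereal"
  v_max :: "nat \<Rightarrow> ereal"
  \<l>_max :: "nat \<times> nat \<Rightarrow> ereal"

definition within_bounds :: "network \<Rightarrow> opf_bounds \<Rightarrow> opf_vars \<Rightarrow> bool" where
  "within_bounds G b x \<longleftrightarrow>
     (\<forall>j\<in>buses G.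
        fst (s_min b j) \<le> ereal (Re (s_var x j)) \<and> ereal (Re (s_var x j)) \<le> fst (s_max b j) \<and>
        snd (s_min b j) \<le> ereal (Im (s_var x j)) \<and> ereal (Im (s_var x j)) \<le> snd (s_max b j) \<and>
        v_min b j \<le> ereal (v_var x j) \<and> ereal (v_var x j) \<le> v_max b j) \<and>
     (\<forall>e\<in>dlines G. 0 \<le> \<l>_var x e \<and> ereal (\<l>_var x e) \<le> \<l>_max b e)"

definition opf_feasible :: "network \<Rightarrow> opf_bounds \<Rightarrow> opf_vars set" where
  "opf_feasible G b = {x \<in> X_tree G. within_bounds G b x}"

definition socp_feasible :: "network \<Rightarrow> opf_bounds \<Rightarrow> opf_vars set" where
  "socp_feasible G b = {x \<in> X_soc G. within_bounds G b x}"

definition opf_optimal :: "network \<Rightarrow> opf_bounds \<Rightarrow> (opf_vars \<Rightarrow> real) \<Rightarrow> opf_vars \<Rightarrow> bool" where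
  "opf_optimal G b f x \<longleftrightarrow> is_arg_min f (\<lambda>y. y \<in> opf_feasible G b) x"

definition socp_optimal :: "network \<Rightarrow> opf_bounds \<Rightarrow> (opf_vars \<Rightarrow> real) \<Rightarrow> opf_vars \<Rightarrow> bool" where
  "socp_optimal G b f x \<longleftrightarrow> is_arg_min f (\<lambda>y. y \<in> socp_feasible G b) x"


section \<open>Monotonicity of the cost function\<close>

text \<open>
  Vectors are ordered componentwise, complex entries as pairs of reals. Strict monotonicity in
  \<open>\<l>\<close> means strict monotonicity in every coordinate: raising some coordinates and lowering none
  strictly raises the cost.
\<close>

definition strictly_increasing_in_\<l> :: "network \<Rightarrow> (opf_vars \<Rightarrow> real) \<Rightarrow> bool" where
  "strictly_increasing_in_\<l> G f \<longleftrightarrow> (\<forall>x\<in>opf_space G. \<forall>y\<in>opf_space G.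
     s_var x = s_var y \<and> v_var x = v_var y \<and> S_var x = S_var y \<and>
     (\<forall>e\<in>dlines G. \<l>_var x e \<le> \<l>_var y e) \<and> \<l>_var x \<noteq> \<l>_var y
     \<longrightarrow> f x < f y)"

definition nondecreasing_in_s :: "network \<Rightarrow> (opf_vars \<Rightarrow> real) \<Rightarrow> bool" where
  "nondecreasing_in_s G f \<longleftrightarrow> (\<forall>x\<in>opf_space G. \<forall>y\<in>opf_space G.
     v_var x = v_var y \<and> \<l>_var x = \<l>_var y \<and> S_var x = S_var y \<and>
     (\<forall>j\<in>buses G. Re (s_var x j) \<le> Re (s_var y j) \<and> Im (s_var x j) \<le> Im (s_var y j))
     \<longrightarrow> f x \<le> f y)"

definition independent_of_S :: "network \<Rightarrow> (opf_vars \<Rightarrow> real) \<Rightarrow> bool" where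
  "independent_of_S G f \<longleftrightarrow> (\<forall>x\<in>opf_space G. \<forall>y\<in>opf_space G.
     s_var x = s_var y \<and> v_var x = v_var y \<and> \<l>_var x = \<l>_var y \<longrightarrow> f x = f y)"

end

theory Submission
  imports Defs
begin

text \<open>
  The relaxation differs from the original problem only in allowing a gap
  \<open>v\<^sub>j \<ell>\<^sub>j\<^sub>k - |S\<^sub>j\<^sub>k|\<^sup>2 > 0\<close> on a directed line. The claim is that such a gap always leaves room for a
  strictly cheaper feasible point, so that an optimal point has none.

  Two facts carry the argument. First, the two directions of a line have the same gap
  (\<open>gap_symmetric\<close>): by the voltage equation, the squared modulus of the quantity
  \<open>\<alpha>\<^sub>j\<^sub>k\<^sup>* v\<^sub>j - z\<^sup>* S\<^sub>j\<^sub>k\<close> falls short of \<open>v\<^sub>j v\<^sub>k\<close> by \<open>|z|\<^sup>2\<close> times the gap, and angle consistency makes the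
  quantities of the two directions conjugate. So a gap in one direction is a gap in both. Second, the
  linear equations of a single line have a solution direction along which the cost falls
  (\<open>shrink_line_feasible\<close>): keep \<open>v\<close>, subtract \<open>d z\<close> from both \<open>S\<^sub>j\<^sub>k\<close> and \<open>S\<^sub>k\<^sub>j\<close>, and subtract
  \<open>2 d Re \<alpha>\<^sub>j\<^sub>k\<close> and \<open>2 d Re \<alpha>\<^sub>k\<^sub>j\<close> from the currents. Positivity of the real parts makes the currents
  fall, and the nonnegative impedance makes the injections at both ends fall, which is harmless
  because injections have no lower bound. The gap absorbs the change in the quadratic inequality when
  \<open>d\<close> is small.
\<close>

section \<open>Line equations on directed lines\<close>

text \<open>
  The equations of a line come in mirrored pairs, so they can be read as one condition on every
  directed line. This removes the arbitrary orientation from all case distinctions below.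
\<close>

lemma dlines_iff: "(j, k) \<in> dlines G \<longleftrightarrow> (j, k) \<in> lines G \<or> (k, j) \<in> lines G"
  by (auto simp: dlines_def)

lemma dlines_sym: "(j, k) \<in> dlines G \<Longrightarrow> (k, j) \<in> dlines G"
  by (auto simp: dlines_iff)

lemma current_eq_dlines:
  "current_eq G x \<longleftrightarrow>
     (\<forall>j k. (j, k) \<in> dlines G \<longrightarrow> v_var x j * \<l>_var x (j, k) = (cmod (S_var x (j, k)))\<^sup>2)"
  by (auto simp: current_eq_def dlines_iff)

lemma current_soc_dlines:
  "current_soc G x \<longleftrightarrow>
     (\<forall>j k. (j, k) \<in> dlines G \<longrightarrow> (cmod (S_var x (j, k)))\<^sup>2 \<le> v_var x j * \<l>_var x (j, k))"
  by (auto simp: current_soc_def dlines_iff)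

lemma voltage_drop_dlines:
  "voltage_drop G x \<longleftrightarrow>
     (\<forall>j k. (j, k) \<in> dlines G \<longrightarrow>
        (cmod (\<alpha> G j k))\<^sup>2 * v_var x j - v_var x k =
        2 * Re (\<alpha> G j k * cnj (zs G j k) * S_var x (j, k))
        - (cmod (zs G j k))\<^sup>2 * \<l>_var x (j, k))"
  unfolding voltage_drop_def dlines_iff by blast

lemma angle_consistency_dlines:
  "angle_consistency G x \<longleftrightarrow>
     (\<forall>j k. (j, k) \<in> dlines G \<longrightarrow>
        cnj (\<alpha> G j k) * of_real (v_var x j) - cnj (zs G j k) * S_var x (j, k) =
        cnj (cnj (\<alpha> G k j) * of_real (v_var x k) - cnj (zs G k j) * S_var x (k, j)))"
  (is "?A \<longleftrightarrow> (\<forall>j k. _ \<longrightarrow> ?W j k = cnj (?W k j))")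
proof -
  have "?W j k = cnj (?W k j) \<longleftrightarrow> ?W k j = cnj (?W j k)" for j k
    by (metis complex_cnj_cnj)
  then show ?thesis
    unfolding angle_consistency_def dlines_iff by blast
qed

lemma zs_sym:
  assumes "power_network G" "(j, k) \<in> dlines G"
  shows "zs G k j = zs G j k" "zs G j k \<noteq> 0"
  using assms by (fastforce simp: power_network_def zs_def dlines_iff)+

lemma dlines_neq:
  assumes "power_network G" "(j, k) \<in> dlines G"
  shows "j \<noteq> k"
  using assms by (auto simp: power_network_def dlines_iff irrefl_def)

lemma finite_neighbours:
  assumes "power_network G"
  shows "finite {k. (j, k) \<in> dlines G}"
proof (rule finite_subset)
  show "{k. (j, k) \<in> dlines G} \<subseteq> buses G"
    using assms by (auto simp: power_network_def dlines_iff)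
qed (simp add: buses_def)


section \<open>The gap of a line\<close>

text \<open>
  If \<open>|a|\<^sup>2 v - u\<close> is eliminated from the expansion of the squared modulus, only the gap
  \<open>v l - |S|\<^sup>2\<close> and the product \<open>v u\<close> of the two squared voltages remain.
\<close>

lemma cmod_voltage_product:
  fixes a z S :: complex and v u l :: real
  assumes "(cmod a)\<^sup>2 * v - u = 2 * Re (a * cnj z * S) - (cmod z)\<^sup>2 * l"
  shows "(cmod (cnj a * of_real v - cnj z * S))\<^sup>2 = v * u - (cmod z)\<^sup>2 * (v * l - (cmod S)\<^sup>2)"
proof -
  have u: "u = (cmod a)\<^sup>2 * v - 2 * Re (a * cnj z * S) + (cmod z)\<^sup>2 * l"
    using assms by simp
  show ?thesis
    unfolding u cmod_power2 by (simp add: power2_eq_square algebra_simps)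
qed

lemma gap_symmetric:
  assumes net: "power_network G"
    and drop: "voltage_drop G x" and angle: "angle_consistency G x"
    and jk: "(j, k) \<in> dlines G"
  shows "v_var x j * \<l>_var x (j, k) - (cmod (S_var x (j, k)))\<^sup>2 =
         v_var x k * \<l>_var x (k, j) - (cmod (S_var x (k, j)))\<^sup>2"
proof -
  let ?W = "\<lambda>j k. cnj (\<alpha> G j k) * of_real (v_var x j) - cnj (zs G j k) * S_var x (j, k)"
  let ?gap = "\<lambda>j k. v_var x j * \<l>_var x (j, k) - (cmod (S_var x (j, k)))\<^sup>2"
  have kj: "(k, j) \<in> dlines G"
    using jk by (rule dlines_sym)
  have W: "(cmod (?W p q))\<^sup>2 = v_var x p * v_var x q - (cmod (zs G p q))\<^sup>2 * ?gap p q"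
    if "(p, q) \<in> dlines G" for p q
    using drop that by (intro cmod_voltage_product) (auto simp: voltage_drop_dlines)
  have "?W j k = cnj (?W k j)"
    using angle jk unfolding angle_consistency_dlines by blast
  then have "cmod (?W j k) = cmod (?W k j)"
    by (metis complex_mod_cnj)
  then have "(cmod (zs G j k))\<^sup>2 * ?gap j k = (cmod (zs G j k))\<^sup>2 * ?gap k j"
    using W[OF jk] W[OF kj] zs_sym(1)[OF net jk] by (simp add: mult.commute)
  then show ?thesis
    using zs_sym(2)[OF net jk] by simp
qed


section \<open>Shrinking the flow on a line\<close>

definition shrink_line :: "network \<Rightarrow> nat \<Rightarrow> nat \<Rightarrow> real \<Rightarrow> opf_vars \<Rightarrow> opf_vars" where
  "shrink_line G j k d x = x\<lparr>
     s_var := (\<lambda>i. if i = j \<or> i = k then s_var x i - of_real d * zs G j k else s_var x i),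
     \<l>_var := (\<lambda>(p, q). if (p, q) = (j, k) \<or> (p, q) = (k, j)
                then \<l>_var x (p, q) - 2 * d * Re (\<alpha> G p q) else \<l>_var x (p, q)),
     S_var := (\<lambda>e. if e = (j, k) \<or> e = (k, j)
                then S_var x e - of_real d * zs G j k else S_var x e)\<rparr>"

lemma shrink_line_space:
  assumes net: "power_network G" and jk: "(j, k) \<in> dlines G" and x: "x \<in> opf_space G"
  shows "shrink_line G j k d x \<in> opf_space G"
proof -
  have "j \<in> buses G" "k \<in> buses G"
    using net jk by (auto simp: power_network_def dlines_iff)
  then show ?thesis
    using x jk dlines_sym[OF jk]
    by (auto simp: opf_space_def shrink_line_def PiE_iff extensional_def)
qed

lemma shrink_line_power_balance:
  assumes net: "power_network G" and jk: "(j, k) \<in> dlines G" and x: "power_balance G x"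
  shows "power_balance G (shrink_line G j k d x)"
  unfolding power_balance_def
proof
  fix i assume i: "i \<in> buses G"
  let ?N = "{m. (i, m) \<in> dlines G}"
  let ?D = "of_real d * zs G j k"
  let ?c = "if i = j then k else j"
  have nz: "j \<noteq> k"
    using net jk by (rule dlines_neq)
  have fin: "finite ?N"
    using net by (rule finite_neighbours)
  \<comment> \<open>A bus has at most one of the two altered flows, namely the one towards \<open>?c\<close>.\<close>
  have "(\<Sum>m\<in>?N. S_var (shrink_line G j k d x) (i, m)) =
        (\<Sum>m\<in>?N. S_var x (i, m) - (if m = ?c then (if i = j \<or> i = k then ?D else 0) else 0))"
    using nz by (intro sum.cong) (auto simp: shrink_line_def)
  also have "\<dots> = s_var x i - (if ?c \<in> ?N then (if i = j \<or> i = k then ?D else 0) else 0)"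
    using x i fin by (simp add: sum_subtractf power_balance_def)
  also have "\<dots> = s_var (shrink_line G j k d x) i"
    using jk dlines_sym[OF jk] by (auto simp: shrink_line_def)
  finally show "s_var (shrink_line G j k d x) i =
      (\<Sum>m\<in>?N. S_var (shrink_line G j k d x) (i, m))" by simp
qed

text \<open>
  The current decrement is dictated by the voltage equation:
  \<open>2 Re (\<alpha> z\<^sup>* \<cdot> d z) = |z|\<^sup>2 \<cdot> 2 d Re \<alpha>\<close>.
\<close>

lemma shrink_line_voltage_drop:
  assumes net: "power_network G" and jk: "(j, k) \<in> dlines G" and x: "voltage_drop G x"
  shows "voltage_drop G (shrink_line G j k d x)"
  unfolding voltage_drop_dlines
proof (intro allI impI)
  fix p q assume pq: "(p, q) \<in> dlines G"
  have old: "(cmod (\<alpha> G p q))\<^sup>2 * v_var x p - v_var x q =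
      2 * Re (\<alpha> G p q * cnj (zs G p q) * S_var x (p, q)) - (cmod (zs G p q))\<^sup>2 * \<l>_var x (p, q)"
    using x pq by (simp add: voltage_drop_dlines)
  show "(cmod (\<alpha> G p q))\<^sup>2 * v_var (shrink_line G j k d x) p - v_var (shrink_line G j k d x) q =
      2 * Re (\<alpha> G p q * cnj (zs G p q) * S_var (shrink_line G j k d x) (p, q))
      - (cmod (zs G p q))\<^sup>2 * \<l>_var (shrink_line G j k d x) (p, q)"
  proof (cases "(p, q) = (j, k) \<or> (p, q) = (k, j)")
    case True
    then have "zs G j k = zs G p q"
      using zs_sym(1)[OF net jk] by auto
    with True have
      "S_var (shrink_line G j k d x) (p, q) = S_var x (p, q) - of_real d * zs G p q"
      "\<l>_var (shrink_line G j k d x) (p, q) = \<l>_var x (p, q) - 2 * d * Re (\<alpha> G p q)"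
      "v_var (shrink_line G j k d x) = v_var x"
      by (auto simp: shrink_line_def)
    moreover have "2 * Re (a * cnj z * (S - of_real d * z)) - (cmod z)\<^sup>2 * (l - 2 * d * Re a) =
          2 * Re (a * cnj z * S) - (cmod z)\<^sup>2 * l" for a z S :: complex and l :: real
      unfolding cmod_power2 by (simp add: power2_eq_square algebra_simps)
    ultimately show ?thesis
      using old by simp
  next
    case False
    then have "S_var (shrink_line G j k d x) (p, q) = S_var x (p, q)"
      "\<l>_var (shrink_line G j k d x) (p, q) = \<l>_var x (p, q)"
      "v_var (shrink_line G j k d x) = v_var x"
      by (auto simp: shrink_line_def)
    then show ?thesis
      using old by (simp only:)
  qed
qed

text \<open>
  Both sides of the equation change by the real number \<open>d |z|\<^sup>2\<close>, which conjugation fixes.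
\<close>

lemma shrink_line_angle_consistency:
  assumes net: "power_network G" and jk: "(j, k) \<in> dlines G" and x: "angle_consistency G x"
  shows "angle_consistency G (shrink_line G j k d x)"
  unfolding angle_consistency_dlines
proof (intro allI impI)
  fix p q assume pq: "(p, q) \<in> dlines G"
  let ?x = "shrink_line G j k d x"
  have old: "cnj (\<alpha> G p q) * of_real (v_var x p) - cnj (zs G p q) * S_var x (p, q) =
        cnj (cnj (\<alpha> G q p) * of_real (v_var x q) - cnj (zs G q p) * S_var x (q, p))"
    using x pq unfolding angle_consistency_dlines by blast
  show "cnj (\<alpha> G p q) * of_real (v_var ?x p) - cnj (zs G p q) * S_var ?x (p, q) =
        cnj (cnj (\<alpha> G q p) * of_real (v_var ?x q) - cnj (zs G q p) * S_var ?x (q, p))"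
  proof (cases "(p, q) = (j, k) \<or> (p, q) = (k, j)")
    case True
    then have z: "zs G j k = zs G p q" "zs G q p = zs G p q"
      using zs_sym(1)[OF net jk] by auto
    have new: "S_var ?x (p, q) = S_var x (p, q) - of_real d * zs G p q"
         "S_var ?x (q, p) = S_var x (q, p) - of_real d * zs G p q"
         "v_var ?x = v_var x"
      unfolding z(1)[symmetric] using True by (auto simp: shrink_line_def)
    have shift: "A - cnj z * (S - of_real d * z) = A - cnj z * S + of_real (d * (cmod z)\<^sup>2)"
      for A S z :: complex
      unfolding cmod_power2
      by (simp add: complex_eq_iff power2_eq_square algebra_simps)
    show ?thesis
      using old unfolding new z(2) shift by simp
  next
    case False
    then have "S_var ?x (p, q) = S_var x (p, q)" "S_var ?x (q, p) = S_var x (q, p)"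
      "v_var ?x = v_var x"
      by (auto simp: shrink_line_def)
    then show ?thesis
      using old by argo
  qed
qed

text \<open>
  A strict second-order cone constraint survives small perturbations; strictness also forces the
  current to be positive, so that it stays nonnegative.
\<close>

lemma soc_gap_perturbation:
  fixes S z :: complex and v l a :: real
  assumes gap: "(cmod S)\<^sup>2 < v * l" and l: "0 \<le> l"
  shows "\<forall>\<^sub>F d in at_right (0::real).
           (cmod (S - of_real d * z))\<^sup>2 \<le> v * (l - 2 * d * a) \<and> 0 \<le> l - 2 * d * a"
proof -
  have "0 \<le> (cmod S)\<^sup>2"
    by simp
  then have "l \<noteq> 0"
    using gap by auto
  then have lpos: "0 < l"
    using l by simp
  have "((\<lambda>d. v * (l - 2 * d * a) - (cmod (S - of_real d * z))\<^sup>2) \<longlongrightarrow>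
          v * (l - 2 * 0 * a) - (cmod (S - of_real 0 * z))\<^sup>2) (at_right 0)"
    by (intro tendsto_intros)
  then have "\<forall>\<^sub>F d in at_right 0. 0 < v * (l - 2 * d * a) - (cmod (S - of_real d * z))\<^sup>2"
    by (rule order_tendstoD) (use gap in simp)
  moreover have "((\<lambda>d. l - 2 * d * a) \<longlongrightarrow> l - 2 * 0 * a) (at_right 0)"
    by (intro tendsto_intros)
  then have "\<forall>\<^sub>F d in at_right 0. 0 < l - 2 * d * a"
    by (rule order_tendstoD) (use lpos in simp)
  ultimately show ?thesis
    by eventually_elim auto
qed

lemma shrink_line_feasible:
  assumes net: "power_network G" and jk: "(j, k) \<in> dlines G"
    and z: "0 \<le> Re (zs G j k)" "0 \<le> Im (zs G j k)"
    and \<alpha>: "0 < Re (\<alpha> G j k)" "0 < Re (\<alpha> G k j)"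
    and smin: "\<forall>i\<in>buses G. s_min b i = (-\<infinity>, -\<infinity>)"
    and x: "x \<in> socp_feasible G b"
    and gap: "(cmod (S_var x (j, k)))\<^sup>2 < v_var x j * \<l>_var x (j, k)"
  obtains d where "0 < d" "shrink_line G j k d x \<in> socp_feasible G b"
proof -
  have kj: "(k, j) \<in> dlines G"
    using jk by (rule dlines_sym)
  have space: "x \<in> opf_space G" and bal: "power_balance G x" and soc: "current_soc G x"
    and drop: "voltage_drop G x" and angle: "angle_consistency G x" and v1: "v_var x 1 = 1"
    and bounds: "within_bounds G b x"
    using x by (auto simp: socp_feasible_def X_soc_def)
  have l0: "0 \<le> \<l>_var x e" "ereal (\<l>_var x e) \<le> \<l>_max b e" if "e \<in> dlines G" for e
    using bounds that by (auto simp: within_bounds_def)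
  have gap': "(cmod (S_var x (k, j)))\<^sup>2 < v_var x k * \<l>_var x (k, j)"
    using gap gap_symmetric[OF net drop angle jk] by linarith
  let ?ok = "\<lambda>p q d. (cmod (S_var x (p, q) - of_real d * zs G j k))\<^sup>2
                \<le> v_var x p * (\<l>_var x (p, q) - 2 * d * Re (\<alpha> G p q))
              \<and> 0 \<le> \<l>_var x (p, q) - 2 * d * Re (\<alpha> G p q)"
  have "\<forall>\<^sub>F d in at_right 0. 0 < d \<and> ?ok j k d \<and> ?ok k j d"
    by (intro eventually_conj eventually_at_right_less
          soc_gap_perturbation[OF gap l0(1)[OF jk]] soc_gap_perturbation[OF gap' l0(1)[OF kj]])
  then have "\<exists>d. 0 < d \<and> ?ok j k d \<and> ?ok k j d"
    by (rule eventually_happens'[rotated]) simp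
  then obtain d where d: "0 < d" and ok: "?ok j k d" "?ok k j d"
    by blast
  let ?x = "shrink_line G j k d x"
  have v: "v_var ?x = v_var x"
    by (simp add: shrink_line_def)
  have "current_soc G ?x"
    using soc ok unfolding current_soc_dlines v by (auto simp: shrink_line_def)
  then have "?x \<in> X_soc G"
    using shrink_line_space[OF net jk space] shrink_line_power_balance[OF net jk bal]
      shrink_line_voltage_drop[OF net jk drop] shrink_line_angle_consistency[OF net jk angle] v1 v
    by (simp add: X_soc_def)
  moreover have "within_bounds G b ?x"
  proof -
    have s: "Re (s_var ?x i) \<le> Re (s_var x i)" "Im (s_var ?x i) \<le> Im (s_var x i)" for i
      using z d by (auto simp: shrink_line_def)
    have l: "\<l>_var ?x e \<le> \<l>_var x e" "e \<in> dlines G \<Longrightarrow> 0 \<le> \<l>_var ?x e" for e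
      using \<alpha> d ok l0(1)[of e] by (cases e; auto simp: shrink_line_def)+
    have "ereal (\<l>_var ?x e) \<le> \<l>_max b e" if "e \<in> dlines G" for e
      using l(1)[of e] l0(2)[OF that] by (meson ereal_less_eq(3) order_trans)
    moreover have "ereal (Re (s_var ?x i)) \<le> fst (s_max b i)"
        "ereal (Im (s_var ?x i)) \<le> snd (s_max b i)" if "i \<in> buses G" for i
      using s[of i] bounds that unfolding within_bounds_def
      by (meson ereal_less_eq(3) order_trans)+
    ultimately show ?thesis
      using bounds smin l(2) by (simp add: within_bounds_def v)
  qed
  ultimately have "?x \<in> socp_feasible G b"
    by (simp add: socp_feasible_def)
  with d show ?thesis
    by (rule that)
qed

text \<open>
  Each monotonicity hypothesis on the cost varies one block of variables only, so the comparison
  passes through two intermediate points, neither of which has to satisfy the network equations.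
\<close>

lemma shrink_line_cheaper:
  assumes net: "power_network G" and jk: "(j, k) \<in> dlines G"
    and z: "0 \<le> Re (zs G j k)" "0 \<le> Im (zs G j k)"
    and \<alpha>: "0 < Re (\<alpha> G j k)" "0 < Re (\<alpha> G k j)"
    and f: "strictly_increasing_in_\<l> G f" "nondecreasing_in_s G f" "independent_of_S G f"
    and x: "x \<in> opf_space G" and d: "0 < d"
  shows "f (shrink_line G j k d x) < f x"
proof -
  let ?x = "shrink_line G j k d x"
  let ?y = "?x\<lparr>\<l>_var := \<l>_var x\<rparr>"
  let ?w = "x\<lparr>S_var := S_var ?x\<rparr>"
  have xs: "?x \<in> opf_space G"
    using net jk x by (rule shrink_line_space)
  then have ys: "?y \<in> opf_space G" and ws: "?w \<in> opf_space G"
    using x by (auto simp: opf_space_def)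
  have "\<l>_var ?x (j, k) \<noteq> \<l>_var x (j, k)"
    using \<alpha> d by (simp add: shrink_line_def)
  then have "\<l>_var ?x \<noteq> \<l>_var ?y"
    by auto
  moreover have "\<forall>e\<in>dlines G. \<l>_var ?x e \<le> \<l>_var ?y e"
    using \<alpha> d by (auto simp: shrink_line_def)
  moreover have "s_var ?x = s_var ?y" "v_var ?x = v_var ?y" "S_var ?x = S_var ?y"
    by simp_all
  ultimately have "f ?x < f ?y"
    using f(1) xs ys unfolding strictly_increasing_in_\<l>_def by blast
  also have "f ?y \<le> f ?w"
  proof -
    have "v_var ?y = v_var ?w" "\<l>_var ?y = \<l>_var ?w" "S_var ?y = S_var ?w"
      by (simp_all add: shrink_line_def)
    moreover have "\<forall>i\<in>buses G. Re (s_var ?y i) \<le> Re (s_var ?w i) \<and> Im (s_var ?y i) \<le> Im (s_var ?w i)"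
      using z d by (auto simp: shrink_line_def)
    ultimately show ?thesis
      using f(2) ys ws unfolding nondecreasing_in_s_def by blast
  qed
  also have "f ?w = f x"
  proof -
    have "s_var ?w = s_var x" "v_var ?w = v_var x" "\<l>_var ?w = \<l>_var x"
      by simp_all
    then show ?thesis
      using f(3) ws x unfolding independent_of_S_def by blast
  qed
  finally show ?thesis .
qed


section \<open>Exactness of the relaxation\<close>

lemma opf_feasible_subset_socp_feasible: "opf_feasible G b \<subseteq> socp_feasible G b"
proof -
  have "current_soc G x" if "current_eq G x" for x
    using that unfolding current_eq_dlines current_soc_dlines by (metis order_refl)
  then show ?thesis
    unfolding opf_feasible_def socp_feasible_def X_tree_def X_soc_def by blast
qed

theorem theorem2:
  fixes G :: network and b :: opf_bounds and f :: "opf_vars \<Rightarrow> real"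
  assumes "power_network G" and "radial G"
    and series_impedance_sign: "\<forall>(j, k) \<in> lines G. 0 \<le> Re (zs G j k) \<and> 0 \<le> Im (zs G j k)"
    and A1: "network_connected G"
    and A2: "strictly_increasing_in_\<l> G f" "nondecreasing_in_s G f" "independent_of_S G f"
    and A3: "opf_feasible G b \<noteq> {}"
    and C1: "\<forall>j\<in>buses G. s_min b j = (-\<infinity>, -\<infinity>)"
    and C2: "\<forall>(j, k) \<in> lines G. 0 < Re (\<alpha> G j k) \<and> 0 < Re (\<alpha> G k j)"
  shows "\<forall>x. socp_optimal G b f x \<longrightarrow> x \<in> X_tree G \<and> opf_optimal G b f x"
proof (intro allI impI)
  fix x assume opt: "socp_optimal G b f x"
  note net = \<open>power_network G\<close>
  have x: "x \<in> socp_feasible G b" and min: "\<And>y. y \<in> socp_feasible G b \<Longrightarrow> \<not> f y < f x"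
    using opt by (auto simp: socp_optimal_def is_arg_min_def)
  have space: "x \<in> opf_space G" and soc: "current_soc G x"
    using x by (auto simp: socp_feasible_def X_soc_def)
  have "current_eq G x"
    unfolding current_eq_dlines
  proof (intro allI impI, rule ccontr)
    fix j k assume jk: "(j, k) \<in> dlines G"
      and ne: "v_var x j * \<l>_var x (j, k) \<noteq> (cmod (S_var x (j, k)))\<^sup>2"
    have gap: "(cmod (S_var x (j, k)))\<^sup>2 < v_var x j * \<l>_var x (j, k)"
      using soc jk ne unfolding current_soc_dlines by (simp add: less_le)
    have z: "0 \<le> Re (zs G j k)" "0 \<le> Im (zs G j k)"
      using series_impedance_sign jk unfolding dlines_iff
      by (metis (no_types, lifting) case_prodD zs_sym(1)[OF net jk])+
    have \<alpha>: "0 < Re (\<alpha> G j k)" "0 < Re (\<alpha> G k j)"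
      using C2 jk by (auto simp: dlines_iff)
    obtain d where "0 < d" "shrink_line G j k d x \<in> socp_feasible G b"
      using shrink_line_feasible[OF net jk z \<alpha> C1 x gap] by blast
    then show False
      using shrink_line_cheaper[OF net jk z \<alpha> A2 space] min by blast
  qed
  then have tree: "x \<in> X_tree G"
    using x by (simp add: socp_feasible_def X_soc_def X_tree_def)
  then have "x \<in> opf_feasible G b"
    using x by (simp add: opf_feasible_def socp_feasible_def)
  then have "opf_optimal G b f x"
    using min opf_feasible_subset_socp_feasible by (auto simp: opf_optimal_def is_arg_min_def)
  with tree show "x \<in> X_tree G \<and> opf_optimal G b f x" ..
qed

end
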